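(* In the setting of the context, for any $\varphi\in L^1(V,\mathrm{d}\mu)$ and any $s\ge0$ one has $\mathbf{U}_h(t,s)\varphi\in\mathscr{D}(\mathbf{B}_h(t))$ for almost every $t\in[s,\infty)$; the mapping $t\in[s,\infty)\mapsto\mathbf{B}_h(t)\mathbf{U}_h(t,s)\varphi\in L^1(V,\mathrm{d}\mu)$ is measurable, with $$\int_s^t\|\mathbf{B}_h(\tau)\mathbf{U}_h(\tau,s)\varphi\|_{L^1(V,\mathrm{d}\mu)}\,\mathrm{d}\tau\le\|\varphi\|_{L^1(V,\mathrm{d}\mu)}-\|\mathbf{U}_h(t,s)\varphi\|_{L^1(V,\mathrm{d}\mu)}\qquad\forall t\ge s,$$ with the equality sign if $$\sigma(t,v)=\Sigma(t,v)\qquad\text{for almost every }(t,v)\in\mathbb{R}_+\times V.$$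
   Context: Let $\mu$ be a Borel measure on $\mathbb{R}^d$ ($d\ge1$) with support $V$. Assume: (1) $(t,v)\in\mathbb{R}_+\times V\mapsto\Sigma(t,v)$ is measurable and non-negative and, for $\mu$-a.e. $v\in V$, $t\mapsto\Sigma(t,v)$ is locally integrable on $\mathbb{R}_+$; (2) $(t,v,v')\in\mathbb{R}_+\times V\times V\mapsto b(t,v,v')$ is measurable and non-negative and $\int_Vb(t,v,v')\,\mathrm{d}\mu(v)\le\Sigma(t,v')$ for a.e. $(t,v')\in\mathbb{R}_+\times V$. Put $\sigma(t,v)=\int_Vb(t,v',v)\,\mathrm{d}\mu(v')$ for $v\in V$, $t\ge0$. For $\varphi\in L^1(V,\mathrm{d}\mu)$ and $t\ge s\ge0$, $[\mathbf{U}_h(t,s)\varphi](v)=\exp\big(-\int_s^t\Sigma(\tau,v)\,\mathrm{d}\tau\big)\varphi(v)$. For $t\ge0$, the operator $\mathbf{B}_h(t)$ is $[\mathbf{B}_h(t)\varphi](v)=\int_Vb(t,v,v')\varphi(v')\,\mathrm{d}\mu(v')$ with domain $\mathscr{D}(\mathbf{B}_h(t))=\{\varphi\in L^1(V,\mathrm{d}\mu):\int_Vb(t,\cdot,v')|\varphi(v')|\,\mathrm{d}\mu(v')\in L^1(V,\mathrm{d}\mu)\}=\{\varphi\in L^1(V,\mathrm{d}\mu):\int_V\sigma(t,v)|\varphi(v)|\,\mathrm{d}\mu(v)<\infty\}$.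
   Formalization: The equality case is stated only for φ ≥ 0 μ-a.e. (for sign-changing φ it fails, e.g. b = Σ = 1 on [0,1] with φ of mean zero), and the Borel measure μ is assumed σ-finite, without which the measurability claim can fail. *)

theory Defs
  imports "HOL-Analysis.Analysis"
begin

definition measure_support :: "'a::topological_space measure \<Rightarrow> 'a set" where
  "measure_support \<mu> = {x. \<forall>U. open U \<longrightarrow> x \<in> U \<longrightarrow> emeasure \<mu> U > 0}"

definition on_support :: "'a::topological_space measure \<Rightarrow> 'a measure" where
  "on_support \<mu> = restrict_space \<mu> (measure_support \<mu>)"

definition half_line :: "real \<Rightarrow> real measure" where
  "half_line s = restrict_space lborel {s..}"

definition locally_integrable_on :: "(real \<Rightarrow> real) \<Rightarrow> real set \<Rightarrow> bool" where
  "locally_integrable_on f S \<longleftrightarrow> (\<forall>K. compact K \<longrightarrow> K \<subseteq> S \<longrightarrow> set_integrable lborel K f)"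

text \<open>
  Elements of \<open>L\<^sup>1(M)\<close> are represented by integrable functions. All operators below respect
  equality almost everywhere.
\<close>

definition L1_norm :: "'a measure \<Rightarrow> ('a \<Rightarrow> real) \<Rightarrow> real" where
  "L1_norm M \<phi> = (\<integral>v. \<bar>\<phi> v\<bar> \<partial>M)"

definition L1_simple :: "'t measure \<Rightarrow> 'a measure \<Rightarrow> ('t \<Rightarrow> 'a \<Rightarrow> real) \<Rightarrow> bool" where
  "L1_simple T M g \<longleftrightarrow>
    (\<exists>(I :: nat set) A h. finite I \<and> (\<forall>i\<in>I. A i \<in> sets T \<and> integrable M (h i)) \<and>
       (\<forall>t\<in>space T. \<forall>v\<in>space M. g t v = (\<Sum>i\<in>I. indicator (A i) t * h i v)))"

text \<open>
  Strong (Bochner) measurability of \<open>t \<mapsto> f t \<in> L\<^sup>1(M)\<close>, where \<open>f t\<close> need only belong to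
  \<open>L\<^sup>1(M)\<close> for almost every \<open>t\<close>: almost everywhere limit, in the norm of \<open>L\<^sup>1(M)\<close>, of a sequence
  of measurable functions taking finitely many values in \<open>L\<^sup>1(M)\<close>.
\<close>

definition L1_measurable :: "'t measure \<Rightarrow> 'a measure \<Rightarrow> ('t \<Rightarrow> 'a \<Rightarrow> real) \<Rightarrow> bool" where
  "L1_measurable T M f \<longleftrightarrow>
    (\<exists>g. (\<forall>n. L1_simple T M (g n)) \<and>
      (AE t in T. integrable M (f t) \<and>
         (\<lambda>n. L1_norm M (\<lambda>v. g n t v - f t v)) \<longlonglongrightarrow> 0))"

text \<open>
  The standing bound by \<open>\<Sigma>\<close> holds only almost everywhere, so this integral may be infinite on a
  null set.
\<close>

definition sigma_h :: "'a measure \<Rightarrow> (real \<Rightarrow> 'a \<Rightarrow> 'a \<Rightarrow> real) \<Rightarrow> real \<Rightarrow> 'a \<Rightarrow> ennreal" where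
  "sigma_h M b t v = (\<integral>\<^sup>+v'. ennreal (b t v' v) \<partial>M)"

definition U_h :: "(real \<Rightarrow> 'a \<Rightarrow> real) \<Rightarrow> real \<Rightarrow> real \<Rightarrow> ('a \<Rightarrow> real) \<Rightarrow> 'a \<Rightarrow> real" where
  "U_h \<Sigma> t s \<phi> v = exp (- (LBINT \<tau>:{s..t}. \<Sigma> \<tau> v)) * \<phi> v"

text \<open>
  For \<open>\<phi>\<close> of changing sign this integral may cancel: with \<open>M\<close> the uniform measure on \<open>[0, 1]\<close>,
  \<open>b = \<Sigma> = 1\<close> and \<open>\<phi>\<close> of mean zero one has \<open>\<sigma> = \<Sigma>\<close> but \<open>B_h\<close> vanishes along \<open>U_h \<phi>\<close>.
  An identity between \<open>L\<^sup>1\<close> norms can therefore only be expected on the positive cone.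
\<close>

definition B_h :: "'a measure \<Rightarrow> (real \<Rightarrow> 'a \<Rightarrow> 'a \<Rightarrow> real) \<Rightarrow> real \<Rightarrow> ('a \<Rightarrow> real) \<Rightarrow> 'a \<Rightarrow> real" where
  "B_h M b t \<phi> v = (\<integral>v'. b t v v' * \<phi> v' \<partial>M)"

text \<open>
  The inner integral is taken in \<^typ>\<open>ennreal\<close> because the Bochner integral of a
  non-integrable function is \<open>0\<close> by convention.
\<close>

definition dom_B_h :: "'a measure \<Rightarrow> (real \<Rightarrow> 'a \<Rightarrow> 'a \<Rightarrow> real) \<Rightarrow> real \<Rightarrow> ('a \<Rightarrow> real) set" where
  "dom_B_h M b t = {\<phi>. integrable M \<phi> \<and>
     (\<integral>\<^sup>+v. (\<integral>\<^sup>+v'. ennreal (b t v v' * \<bar>\<phi> v'\<bar>) \<partial>M) \<partial>M) < \<infinity>}"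

lemma dom_B_h_eq:
  assumes M: "sigma_finite_measure M"
    and b: "(\<lambda>(v, v'). b t v v') \<in> borel_measurable (M \<Otimes>\<^sub>M M)"
    and nonneg: "\<And>v v'. v \<in> space M \<Longrightarrow> v' \<in> space M \<Longrightarrow> 0 \<le> b t v v'"
  shows "dom_B_h M b t =
    {\<phi>. integrable M \<phi> \<and> (\<integral>\<^sup>+v. sigma_h M b t v * ennreal \<bar>\<phi> v\<bar> \<partial>M) < \<infinity>}"
proof -
  interpret M: sigma_finite_measure M by fact
  interpret MM: pair_sigma_finite M M ..
  have "(\<integral>\<^sup>+v. (\<integral>\<^sup>+v'. ennreal (b t v v' * \<bar>\<phi> v'\<bar>) \<partial>M) \<partial>M)
      = (\<integral>\<^sup>+v. sigma_h M b t v * ennreal \<bar>\<phi> v\<bar> \<partial>M)" if "integrable M \<phi>" for \<phi>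
  proof -
    have [measurable]: "\<phi> \<in> borel_measurable M" using that by simp
    note b[measurable]
    have m: "(\<lambda>(v, v'). ennreal (b t v v' * \<bar>\<phi> v'\<bar>)) \<in> borel_measurable (M \<Otimes>\<^sub>M M)"
      by measurable
    have "(\<integral>\<^sup>+v. (\<integral>\<^sup>+v'. ennreal (b t v v' * \<bar>\<phi> v'\<bar>) \<partial>M) \<partial>M)
        = (\<integral>\<^sup>+v'. (\<integral>\<^sup>+v. ennreal (b t v v' * \<bar>\<phi> v'\<bar>) \<partial>M) \<partial>M)"
      using MM.Fubini'[OF m] by simp
    also have "\<dots> = (\<integral>\<^sup>+v'. sigma_h M b t v' * ennreal \<bar>\<phi> v'\<bar> \<partial>M)"
    proof (rule nn_integral_cong)
      fix v' assume v': "v' \<in> space M"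
      have "(\<integral>\<^sup>+v. ennreal (b t v v' * \<bar>\<phi> v'\<bar>) \<partial>M) = (\<integral>\<^sup>+v. ennreal (b t v v') * ennreal \<bar>\<phi> v'\<bar> \<partial>M)"
        by (rule nn_integral_cong) (simp add: ennreal_mult nonneg v')
      also have "\<dots> = sigma_h M b t v' * ennreal \<bar>\<phi> v'\<bar>"
        unfolding sigma_h_def using v' by (intro nn_integral_multc) measurable
      finally show "(\<integral>\<^sup>+v. ennreal (b t v v' * \<bar>\<phi> v'\<bar>) \<partial>M) = sigma_h M b t v' * ennreal \<bar>\<phi> v'\<bar>" .
    qed
    finally show ?thesis .
  qed
  then show ?thesis unfolding dom_B_h_def by auto
qed

end

theory Submission
  imports Defs
begin

text \<open>
  The estimate is a mass balance. Let \<open>F(t, v)\<close> be the integral of \<open>\<Sigma>(\<tau>, v)\<close> over \<open>s \<le> \<tau> \<le> t\<close>, so that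
  \<open>U_h(t, s) \<phi> = exp (- F(t, v)) \<phi>(v)\<close>. For almost every \<open>v\<close> the integral of \<open>\<Sigma> exp (- F)\<close> over
  \<open>s \<le> \<tau> \<le> t\<close> is \<open>1 - exp (- F(t, v))\<close> (\<open>attenuated_rate_integral\<close>). Multiplying by \<open>|\<phi>(v)|\<close>,
  integrating over \<open>v\<close> and applying Tonelli's theorem shows that the mass absorbed up to time \<open>t\<close> is
  exactly the loss of norm (\<open>absorption_balance\<close>). A second use of Tonelli's theorem, at fixed time,
  shows that the mass emitted by \<open>B_h\<close>, measured without cancellation, is the integral of
  \<open>\<sigma> |U_h \<phi>|\<close>. Since \<open>\<sigma> \<le> \<Sigma>\<close>, emission never exceeds absorption, which gives both the domain
  statement and the inequality. If \<open>\<sigma> = \<Sigma>\<close> the two agree, and for \<open>\<phi> \<ge> 0\<close> the emitted mass is the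
  norm of \<open>B_h U_h \<phi>\<close>, which gives equality.

  The same bound, uniform in \<open>t\<close>, shows that \<open>(t, v) \<mapsto> (B_h(t) U_h(t, s) \<phi>)(v)\<close> is integrable on the
  product of the half line and the velocity space (\<open>integrable_gain\<close>). Strong measurability follows
  from the density of simple functions built on rectangles in \<open>L\<^sup>1\<close> of a product
  (\<open>L1_measurable_integrable\<close>).
\<close>

section \<open>Attenuation by an integrable rate\<close>

text \<open>
  Cutting the range of \<open>F\<close> into \<open>n\<close> equal parts, which is possible by the intermediate value
  theorem, bounds the total increment of \<open>G\<close> by \<open>n (D / n)\<^sup>2\<close> with \<open>D = F t - F s\<close>, and this tends to
  zero. The quadratic bound makes \<open>G\<close> a function of \<open>F\<close> with vanishing derivative.
\<close>
lemma quadratic_increments_imp_equal_endpoints: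
  fixes F G :: "real \<Rightarrow> real"
  assumes "s \<le> t" and cont: "continuous_on {s..t} F"
    and quad: "\<And>x y. x \<in> {s..t} \<Longrightarrow> y \<in> {s..t} \<Longrightarrow> \<bar>G y - G x\<bar> \<le> (F y - F x)\<^sup>2"
  shows "G t = G s"
proof -
  define D where "D = F t - F s"
  have bound: "\<bar>G t - G s\<bar> \<le> D\<^sup>2 / real n" if n: "0 < n" for n :: nat
  proof -
    have "\<exists>x\<in>{s..t}. F x = F s + real k / real n * D" if "k \<le> n" for k
    proof -
      have q: "0 \<le> real k / real n" "real k / real n \<le> 1" using that n by auto
      have conn: "connected (F ` {s..t})" by (intro connected_continuous_image cont) simp
      have "F s + real k / real n * D \<in> closed_segment (F s) (F t)"
        unfolding in_segment D_def using q n by (intro exI[of _ "real k / real n"]) (auto simp: field_simps)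
      also have "\<dots> \<subseteq> F ` {s..t}"
        using conn \<open>s \<le> t\<close>
        by (intro closed_segment_subset) (auto simp flip: is_interval_convex_1 simp: is_interval_connected_1)
      finally show ?thesis by auto
    qed
    \<comment> \<open>\<open>x k\<close> need not increase with \<open>k\<close>; only the equally spaced values of \<open>F\<close> matter.\<close>
    then obtain x where x: "\<And>k. k \<le> n \<Longrightarrow> x k \<in> {s..t}"
      "\<And>k. k \<le> n \<Longrightarrow> F (x k) = F s + real k / real n * D" by metis
    have "\<bar>G (x k) - G s\<bar> \<le> real k * (D / real n)\<^sup>2" if "k \<le> n" for k
      using that
    proof (induction k)
      case 0
      then show ?case using quad[of s "x 0"] x[of 0] \<open>s \<le> t\<close> by simp
    next
      case (Suc k)
      have "F (x (Suc k)) - F (x k) = D / real n"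
        using Suc.prems x(2)[of k] x(2)[of "Suc k"] by (simp add: field_simps)
      with quad[OF x(1)[of k] x(1)[of "Suc k"]] Suc.prems
      have "\<bar>G (x (Suc k)) - G (x k)\<bar> \<le> (D / real n)\<^sup>2" by simp
      with Suc.IH Suc.prems show ?case by (simp add: algebra_simps)
    qed
    from this[of n] have "\<bar>G (x n) - G s\<bar> \<le> D\<^sup>2 / real n"
      using n by (simp add: power2_eq_square)
    \<comment> \<open>\<open>x n\<close> may differ from \<open>t\<close>, but \<open>F\<close> agrees there, hence so does \<open>G\<close>.\<close>
    moreover have "\<bar>G t - G (x n)\<bar> \<le> 0"
      using quad[OF x(1)[of n], of t] x(2)[of n] n \<open>s \<le> t\<close> by (simp add: D_def)
    ultimately show ?thesis by linarith
  qed
  have "(\<lambda>n. D\<^sup>2 / real n) \<longlonglongrightarrow> 0" by (rule lim_const_over_n)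
  then have "\<bar>G t - G s\<bar> \<le> 0"
    by (rule LIMSEQ_le_const) (use bound in \<open>auto intro!: exI[of _ 1]\<close>)
  then show ?thesis by simp
qed

lemma exp_neg_increment_bounds:
  fixes x y :: real
  assumes "x \<le> y"
  shows "(y - x) * exp (- y) \<le> exp (- x) - exp (- y)" "exp (- x) - exp (- y) \<le> (y - x) * exp (- x)"
proof -
  have "(1 + (y - x)) * exp (- y) \<le> exp (y - x) * exp (- y)"
    by (intro mult_right_mono exp_ge_add_one_self) simp
  then show "(y - x) * exp (- y) \<le> exp (- x) - exp (- y)"
    by (simp add: algebra_simps flip: exp_add)
  have "(1 + (x - y)) * exp (- x) \<le> exp (x - y) * exp (- x)"
    by (intro mult_right_mono exp_ge_add_one_self) simp
  then show "exp (- x) - exp (- y) \<le> (y - x) * exp (- x)"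
    by (simp add: algebra_simps flip: exp_add)
qed

text \<open>
  Formally this is the fundamental theorem of calculus for \<open>exp (- F)\<close>, whose derivative \<open>- S exp (- F)\<close>
  exists only almost everywhere because \<open>S\<close> is merely integrable. Differentiation is avoided: on an
  interval on which \<open>F\<close> grows by \<open>D\<close>, both the integral of \<open>S exp (- F)\<close> and the decrease of \<open>exp (- F)\<close>
  lie between \<open>D\<close> times the smallest and \<open>D\<close> times the largest value of \<open>exp (- F)\<close>, hence differ by
  at most \<open>D\<^sup>2\<close>.
\<close>
lemma attenuated_rate_integral:
  fixes S :: "real \<Rightarrow> real"
  assumes "s \<le> t" and S: "set_integrable lborel {s..t} S"
    and nonneg: "\<And>\<tau>. \<tau> \<in> {s..t} \<Longrightarrow> 0 \<le> S \<tau>"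
  defines "F \<equiv> \<lambda>x. LBINT \<tau>:{s..x}. S \<tau>"
  shows "set_integrable lborel {s..t} (\<lambda>\<tau>. S \<tau> * exp (- F \<tau>))"
    and "(LBINT \<tau>:{s..t}. S \<tau> * exp (- F \<tau>)) = 1 - exp (- F t)"
proof -
  have S_sub: "set_integrable lborel {s..x} S" if "x \<le> t" for x
    using S by (rule set_integrable_subset) (use that in auto)
  have S_HK: "S integrable_on {x..y}" if "s \<le> x" "y \<le> t" for x y
    using set_borel_integral_eq_integral(1)[OF S] by (rule integrable_on_subinterval) (use that in auto)
  have F_HK: "F x = integral {s..x} S" if "x \<le> t" for x
    unfolding F_def by (rule set_borel_integral_eq_integral(2)[OF S_sub[OF that]])
  have F_diff: "F y - F x = integral {x..y} S" if "s \<le> x" "x \<le> y" "y \<le> t" for x y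
    using that Henstock_Kurzweil_Integration.integral_combine[OF that(1,2) S_HK] by (simp add: F_HK)
  have F_mono: "F x \<le> F y" if "s \<le> x" "x \<le> y" "y \<le> t" for x y
    using F_diff[OF that] Henstock_Kurzweil_Integration.integral_nonneg[OF S_HK, of x y] nonneg that by fastforce
  have F_nonneg: "0 \<le> F x" if "s \<le> x" "x \<le> t" for x
    using F_mono[of s x] F_HK[of s] that by simp
  have contF: "continuous_on {s..t} F"
    using indefinite_integral_continuous_1[OF S_HK[of s t]]
    by (rule continuous_on_cong[THEN iffD1, rotated 2]) (auto simp: F_HK)
  let ?E = "\<lambda>\<tau>. S \<tau> * exp (- F \<tau>)"
  show E: "set_integrable lborel {s..t} ?E"
    unfolding set_integrable_def
  proof (rule Bochner_Integration.integrable_bound)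
    show "integrable lborel (\<lambda>\<tau>. indicator {s..t} \<tau> *\<^sub>R S \<tau>)" using S by (simp add: set_integrable_def)
    have "(\<lambda>\<tau>. indicator {s..t} \<tau> *\<^sub>R S \<tau>) \<in> borel_measurable lborel"
      using S by (simp add: set_integrable_def borel_measurable_integrable)
    moreover have "(\<lambda>\<tau>. indicator {s..t} \<tau> *\<^sub>R exp (- F \<tau>)) \<in> borel_measurable borel"
      by (intro borel_measurable_continuous_on_indicator continuous_intros contF) simp
    then have "(\<lambda>\<tau>. indicator {s..t} \<tau> *\<^sub>R exp (- F \<tau>)) \<in> borel_measurable lborel" by simp
    ultimately have "(\<lambda>\<tau>. (indicator {s..t} \<tau> *\<^sub>R S \<tau>) * (indicator {s..t} \<tau> *\<^sub>R exp (- F \<tau>))) \<in> borel_measurable lborel"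
      by measurable
    then show "(\<lambda>\<tau>. indicator {s..t} \<tau> *\<^sub>R ?E \<tau>) \<in> borel_measurable lborel"
      by (rule measurable_cong[THEN iffD1, rotated]) (auto split: split_indicator)
    show "AE \<tau> in lborel. norm (indicator {s..t} \<tau> *\<^sub>R ?E \<tau>) \<le> norm (indicator {s..t} \<tau> *\<^sub>R S \<tau>)"
      using F_nonneg nonneg by (intro AE_I2) (auto split: split_indicator simp: abs_mult intro!: mult_left_le)
  qed
  have E_HK: "?E integrable_on {x..y}" if "s \<le> x" "y \<le> t" for x y
    using set_borel_integral_eq_integral(1)[OF E] by (rule integrable_on_subinterval) (use that in auto)
  define G where "G x = integral {s..x} ?E + exp (- F x)" for x
  have "G t = G s"
  proof (rule quadratic_increments_imp_equal_endpoints[OF \<open>s \<le> t\<close> contF])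
    have "\<bar>G y - G x\<bar> \<le> (F y - F x)\<^sup>2" if xy: "s \<le> x" "x \<le> y" "y \<le> t" for x y
    proof -
      let ?D = "F y - F x" and ?K = "integral {x..y} ?E"
      have D: "0 \<le> ?D" using F_mono[OF xy] by simp
      have G: "G y - G x = ?K - (exp (- F x) - exp (- F y))"
        using Henstock_Kurzweil_Integration.integral_combine[OF xy(1,2) E_HK] xy by (simp add: G_def)
      have "integral {x..y} (\<lambda>\<tau>. S \<tau> * exp (- F y)) \<le> ?K"
        using xy nonneg
        by (intro integral_le integrable_on_mult_left S_HK E_HK mult_left_mono) (auto intro: F_mono)
      then have lower: "?D * exp (- F y) \<le> ?K" using F_diff[OF xy] by simp
      have "?K \<le> integral {x..y} (\<lambda>\<tau>. S \<tau> * exp (- F x))"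
        using xy nonneg
        by (intro integral_le integrable_on_mult_left S_HK E_HK mult_left_mono) (auto intro: F_mono)
      then have upper: "?K \<le> ?D * exp (- F x)" using F_diff[OF xy] by simp
      note e = exp_neg_increment_bounds[OF F_mono[OF xy]]
      have "\<bar>G y - G x\<bar> \<le> ?D * (exp (- F x) - exp (- F y))"
        unfolding G abs_le_iff using lower upper e by (auto simp: algebra_simps)
      also have "\<dots> \<le> ?D * (?D * exp (- F x))" by (intro mult_left_mono e D)
      also have "\<dots> \<le> ?D * (?D * 1)"
        using F_nonneg[of x] xy D by (intro mult_left_mono) auto
      finally show ?thesis by (simp add: power2_eq_square)
    qed
    then show "\<bar>G y - G x\<bar> \<le> (F y - F x)\<^sup>2" if "x \<in> {s..t}" "y \<in> {s..t}" for x y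
      using that by (cases "x \<le> y") (force simp: abs_minus_commute power2_commute)+
  qed
  moreover have "F s = 0" using F_HK[of s] \<open>s \<le> t\<close> by simp
  ultimately show "(LBINT \<tau>:{s..t}. ?E \<tau>) = 1 - exp (- F t)"
    unfolding set_borel_integral_eq_integral(2)[OF E] by (simp add: G_def)
qed

section \<open>Strong measurability of integrable functions on a product\<close>

text \<open>
  Arbitrary finite index types, unlike natural numbers, make sums of simple functions immediate: the
  disjoint union of the two index sets indexes the sum.
\<close>
lemma L1_simpleI:
  assumes "finite I" "\<And>i. i \<in> I \<Longrightarrow> A i \<in> sets T" "\<And>i. i \<in> I \<Longrightarrow> integrable M (h i)"
    and "\<And>t v. t \<in> space T \<Longrightarrow> v \<in> space M \<Longrightarrow> g t v = (\<Sum>i\<in>I. indicator (A i) t * h i v)"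
  shows "L1_simple T M g"
proof -
  obtain e where e: "bij_betw e {0..<card I} I" using ex_bij_betw_nat_finite[OF \<open>finite I\<close>] by auto
  then have eI: "e k \<in> I" if "k < card I" for k using that by (auto simp: bij_betw_def)
  show ?thesis
    unfolding L1_simple_def
    by (rule exI[of _ "{0..<card I}"], rule exI[of _ "A \<circ> e"], rule exI[of _ "h \<circ> e"])
      (use assms eI in \<open>auto simp: sum.reindex_bij_betw[OF e, symmetric]\<close>)
qed

lemma L1_simpleE:
  assumes "L1_simple T M g"
  obtains I :: "nat set" and A h where "finite I" "\<And>i. i \<in> I \<Longrightarrow> A i \<in> sets T"
    "\<And>i. i \<in> I \<Longrightarrow> integrable M (h i)"
    "\<And>t v. t \<in> space T \<Longrightarrow> v \<in> space M \<Longrightarrow> g t v = (\<Sum>i\<in>I. indicator (A i) t * h i v)"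
  using assms unfolding L1_simple_def by blast

lemma L1_simple_add:
  assumes "L1_simple T M f" "L1_simple T M g"
  shows "L1_simple T M (\<lambda>t v. f t v + g t v)"
proof -
  obtain I :: "nat set" and A h where f: "finite I" "\<And>i. i \<in> I \<Longrightarrow> A i \<in> sets T"
    "\<And>i. i \<in> I \<Longrightarrow> integrable M (h i)"
    "\<And>t v. t \<in> space T \<Longrightarrow> v \<in> space M \<Longrightarrow> f t v = (\<Sum>i\<in>I. indicator (A i) t * h i v)"
    using assms(1) by (rule L1_simpleE) blast
  obtain J :: "nat set" and B k where g: "finite J" "\<And>i. i \<in> J \<Longrightarrow> B i \<in> sets T"
    "\<And>i. i \<in> J \<Longrightarrow> integrable M (k i)"
    "\<And>t v. t \<in> space T \<Longrightarrow> v \<in> space M \<Longrightarrow> g t v = (\<Sum>i\<in>J. indicator (B i) t * k i v)"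
    using assms(2) by (rule L1_simpleE) blast
  show ?thesis
    by (rule L1_simpleI[of "I <+> J" "case_sum A B" T M "case_sum h k"])
      (use f g in \<open>auto simp: sum.Plus simp del: sum_mult_indicator sum_indicator_mult\<close>)
qed

lemma L1_simple_scale:
  assumes "L1_simple T M f"
  shows "L1_simple T M (\<lambda>t v. c * f t v)"
proof -
  obtain I :: "nat set" and A h where "finite I" "\<And>i. i \<in> I \<Longrightarrow> A i \<in> sets T"
    "\<And>i. i \<in> I \<Longrightarrow> integrable M (h i)"
    "\<And>t v. t \<in> space T \<Longrightarrow> v \<in> space M \<Longrightarrow> f t v = (\<Sum>i\<in>I. indicator (A i) t * h i v)"
    using assms by (rule L1_simpleE) blast
  then show ?thesis
    by (intro L1_simpleI[of I A T M "\<lambda>i v. c * h i v"]) (auto simp: sum_distrib_left ac_simps simp del: sum_mult_indicator sum_indicator_mult)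
qed

lemma L1_simple_rectangle:
  assumes "A \<in> sets T" "integrable M h"
  shows "L1_simple T M (\<lambda>t v. indicator A t * h v)"
  by (rule L1_simpleI[of "{()}" "\<lambda>_. A" T M "\<lambda>_. h"]) (use assms in auto)

lemma borel_measurable_L1_simple:
  assumes "L1_simple T M g"
  shows "(\<lambda>(t, v). g t v) \<in> borel_measurable (T \<Otimes>\<^sub>M M)"
proof -
  obtain I :: "nat set" and A h where *: "finite I" "\<And>i. i \<in> I \<Longrightarrow> A i \<in> sets T"
    "\<And>i. i \<in> I \<Longrightarrow> integrable M (h i)"
    "\<And>t v. t \<in> space T \<Longrightarrow> v \<in> space M \<Longrightarrow> g t v = (\<Sum>i\<in>I. indicator (A i) t * h i v)"
    using assms(1) by (rule L1_simpleE) blast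
  have "(\<lambda>(t, v). \<Sum>i\<in>I. indicator (A i) t * h i v) \<in> borel_measurable (T \<Otimes>\<^sub>M M)"
    unfolding split_beta
  proof (intro borel_measurable_sum borel_measurable_times)
    fix i assume i: "i \<in> I"
    show "(\<lambda>x. indicator (A i) (fst x) :: real) \<in> borel_measurable (T \<Otimes>\<^sub>M M)"
      using *(2)[OF i] by measurable
    show "(\<lambda>x. h i (snd x)) \<in> borel_measurable (T \<Otimes>\<^sub>M M)"
      using borel_measurable_integrable[OF *(3)[OF i]] by measurable
  qed
  then show ?thesis
    by (rule measurable_cong[THEN iffD1, rotated]) (use *(4) in \<open>auto simp: space_pair_measure\<close>)
qed

text \<open>
  Membership in the closure, for the distance of \<open>L\<^sup>1(T \<otimes> M)\<close>, of the simple \<open>L\<^sup>1(M)\<close>-valued functions.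
  The distance is an extended integral because simple functions need not be integrable on the
  product: their level sets may have infinite measure.
\<close>
definition L1_simple_limit :: "'t measure \<Rightarrow> 'a measure \<Rightarrow> ('t \<times> 'a \<Rightarrow> real) \<Rightarrow> bool" where
  "L1_simple_limit T M f \<longleftrightarrow> f \<in> borel_measurable (T \<Otimes>\<^sub>M M) \<and>
    (\<forall>e>0. \<exists>g. L1_simple T M g \<and>
       (\<integral>\<^sup>+x. ennreal \<bar>f x - case_prod g x\<bar> \<partial>(T \<Otimes>\<^sub>M M)) < ennreal e)"

lemma L1_simple_limitE:
  assumes "L1_simple_limit T M f" "0 < e"
  obtains g where "L1_simple T M g"
    "(\<integral>\<^sup>+x. ennreal \<bar>f x - case_prod g x\<bar> \<partial>(T \<Otimes>\<^sub>M M)) < ennreal e"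
  using assms unfolding L1_simple_limit_def by blast

lemma L1_simple_limit_simple:
  assumes "L1_simple T M g"
  shows "L1_simple_limit T M (\<lambda>(t, v). g t v)"
  unfolding L1_simple_limit_def using assms borel_measurable_L1_simple[OF assms]
  by (auto intro!: exI[of _ g])

lemma L1_simple_limit_add:
  assumes f: "L1_simple_limit T M f" and f': "L1_simple_limit T M f'"
  shows "L1_simple_limit T M (\<lambda>x. f x + f' x)"
  unfolding L1_simple_limit_def
proof safe
  have [measurable]: "f \<in> borel_measurable (T \<Otimes>\<^sub>M M)" "f' \<in> borel_measurable (T \<Otimes>\<^sub>M M)"
    using f f' by (auto simp: L1_simple_limit_def)
  show "(\<lambda>x. f x + f' x) \<in> borel_measurable (T \<Otimes>\<^sub>M M)" by measurable
  fix e :: real assume "0 < e"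
  then have "0 < e / 2" by simp
  obtain g where g: "L1_simple T M g"
    "(\<integral>\<^sup>+x. ennreal \<bar>f x - case_prod g x\<bar> \<partial>(T \<Otimes>\<^sub>M M)) < ennreal (e / 2)"
    by (rule L1_simple_limitE[OF f \<open>0 < e / 2\<close>])
  obtain g' where g': "L1_simple T M g'"
    "(\<integral>\<^sup>+x. ennreal \<bar>f' x - case_prod g' x\<bar> \<partial>(T \<Otimes>\<^sub>M M)) < ennreal (e / 2)"
    by (rule L1_simple_limitE[OF f' \<open>0 < e / 2\<close>])
  note [measurable] = g(1)[THEN borel_measurable_L1_simple] g'(1)[THEN borel_measurable_L1_simple]
  have "(\<integral>\<^sup>+x. ennreal \<bar>(f x + f' x) - (case x of (t, v) \<Rightarrow> g t v + g' t v)\<bar> \<partial>(T \<Otimes>\<^sub>M M))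
      \<le> (\<integral>\<^sup>+x. ennreal \<bar>f x - case_prod g x\<bar> + ennreal \<bar>f' x - case_prod g' x\<bar> \<partial>(T \<Otimes>\<^sub>M M))"
    by (intro nn_integral_mono) (auto simp flip: ennreal_plus split: prod.splits)
  also have "\<dots> = (\<integral>\<^sup>+x. ennreal \<bar>f x - case_prod g x\<bar> \<partial>(T \<Otimes>\<^sub>M M)) +
      (\<integral>\<^sup>+x. ennreal \<bar>f' x - case_prod g' x\<bar> \<partial>(T \<Otimes>\<^sub>M M))"
    by (rule nn_integral_add) measurable
  also have "\<dots> < ennreal (e / 2) + ennreal (e / 2)" by (rule add_strict_mono[OF g(2) g'(2)])
  also have "\<dots> = ennreal e" using \<open>0 < e\<close> by (simp flip: ennreal_plus)
  finally show "\<exists>g. L1_simple T M g \<and>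
      (\<integral>\<^sup>+x. ennreal \<bar>f x + f' x - case_prod g x\<bar> \<partial>(T \<Otimes>\<^sub>M M)) < ennreal e"
    using L1_simple_add[OF g(1) g'(1)] by (intro exI[of _ "\<lambda>t v. g t v + g' t v"]) auto
qed

lemma L1_simple_limit_scale:
  assumes f: "L1_simple_limit T M f"
  shows "L1_simple_limit T M (\<lambda>x. c * f x)"
  unfolding L1_simple_limit_def
proof safe
  have [measurable]: "f \<in> borel_measurable (T \<Otimes>\<^sub>M M)" using f by (auto simp: L1_simple_limit_def)
  show "(\<lambda>x. c * f x) \<in> borel_measurable (T \<Otimes>\<^sub>M M)" by measurable
  fix e :: real assume "0 < e"
  then have "0 < e / (\<bar>c\<bar> + 1)" by (auto intro!: divide_pos_pos)
  with f obtain g where g: "L1_simple T M g"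
    "(\<integral>\<^sup>+x. ennreal \<bar>f x - case_prod g x\<bar> \<partial>(T \<Otimes>\<^sub>M M)) < ennreal (e / (\<bar>c\<bar> + 1))"
    by (rule L1_simple_limitE)
  note [measurable] = g(1)[THEN borel_measurable_L1_simple]
  have "(\<integral>\<^sup>+x. ennreal \<bar>c * f x - (case x of (t, v) \<Rightarrow> c * g t v)\<bar> \<partial>(T \<Otimes>\<^sub>M M))
      = (\<integral>\<^sup>+x. ennreal \<bar>c\<bar> * ennreal \<bar>f x - case_prod g x\<bar> \<partial>(T \<Otimes>\<^sub>M M))"
    by (intro nn_integral_cong)
      (auto simp flip: ennreal_mult abs_mult simp: algebra_simps split: prod.splits)
  also have "\<dots> = ennreal \<bar>c\<bar> * (\<integral>\<^sup>+x. ennreal \<bar>f x - case_prod g x\<bar> \<partial>(T \<Otimes>\<^sub>M M))"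
    by (rule nn_integral_cmult) measurable
  also have "\<dots> \<le> ennreal \<bar>c\<bar> * ennreal (e / (\<bar>c\<bar> + 1))"
    using g(2) by (intro mult_left_mono) auto
  also have "\<dots> = ennreal (\<bar>c\<bar> * (e / (\<bar>c\<bar> + 1)))" using \<open>0 < e\<close> by (simp flip: ennreal_mult)
  also have "\<dots> < ennreal e" using \<open>0 < e\<close> by (intro ennreal_lessI) (auto simp: field_simps)
  finally show "\<exists>g. L1_simple T M g \<and>
      (\<integral>\<^sup>+x. ennreal \<bar>c * f x - case_prod g x\<bar> \<partial>(T \<Otimes>\<^sub>M M)) < ennreal e"
    using L1_simple_scale[OF g(1)] by (intro exI[of _ "\<lambda>t v. c * g t v"]) auto
qed

lemma L1_simple_limit_dominated:
  assumes s: "\<And>n. L1_simple_limit T M (s n)"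
    and lim: "\<And>x. x \<in> space (T \<Otimes>\<^sub>M M) \<Longrightarrow> (\<lambda>n. s n x) \<longlonglongrightarrow> f x"
    and w: "integrable (T \<Otimes>\<^sub>M M) w"
    and bound: "\<And>n x. x \<in> space (T \<Otimes>\<^sub>M M) \<Longrightarrow> \<bar>s n x\<bar> \<le> w x"
  shows "L1_simple_limit T M f"
  unfolding L1_simple_limit_def
proof safe
  have [measurable]: "s n \<in> borel_measurable (T \<Otimes>\<^sub>M M)" for n using s by (auto simp: L1_simple_limit_def)
  show [measurable]: "f \<in> borel_measurable (T \<Otimes>\<^sub>M M)"
    by (rule borel_measurable_LIMSEQ_real[OF lim]) auto
  have [measurable]: "w \<in> borel_measurable (T \<Otimes>\<^sub>M M)" using w by auto
  have "(\<lambda>n. \<integral>\<^sup>+x. ennreal (norm (f x - s n x)) \<partial>(T \<Otimes>\<^sub>M M)) \<longlonglongrightarrow> 0"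
  proof (rule nn_integral_dominated_convergence_norm[where w = w])
    show "(\<integral>\<^sup>+x. ennreal (w x) \<partial>(T \<Otimes>\<^sub>M M)) < \<infinity>"
    proof -
      have "(\<integral>\<^sup>+x. ennreal (w x) \<partial>(T \<Otimes>\<^sub>M M)) \<le> (\<integral>\<^sup>+x. ennreal (norm (w x)) \<partial>(T \<Otimes>\<^sub>M M))"
        by (intro nn_integral_mono ennreal_leI) auto
      also have "\<dots> < \<infinity>" using w by (simp add: integrable_iff_bounded)
      finally show ?thesis .
    qed
  qed (use lim bound in auto)
  moreover fix e :: real assume "0 < e"
  ultimately have "\<forall>\<^sub>F n in sequentially. (\<integral>\<^sup>+x. ennreal (norm (f x - s n x)) \<partial>(T \<Otimes>\<^sub>M M)) < ennreal (e / 2)"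
    by (intro order_tendstoD) auto
  then obtain n where n: "(\<integral>\<^sup>+x. ennreal \<bar>f x - s n x\<bar> \<partial>(T \<Otimes>\<^sub>M M)) < ennreal (e / 2)"
    by (auto simp: eventually_sequentially)
  obtain g where g: "L1_simple T M g"
    "(\<integral>\<^sup>+x. ennreal \<bar>s n x - case_prod g x\<bar> \<partial>(T \<Otimes>\<^sub>M M)) < ennreal (e / 2)"
    by (rule L1_simple_limitE[OF s[of n] half_gt_zero[OF \<open>0 < e\<close>]])
  note [measurable] = g(1)[THEN borel_measurable_L1_simple]
  have "(\<integral>\<^sup>+x. ennreal \<bar>f x - case_prod g x\<bar> \<partial>(T \<Otimes>\<^sub>M M))
      \<le> (\<integral>\<^sup>+x. ennreal \<bar>f x - s n x\<bar> + ennreal \<bar>s n x - case_prod g x\<bar> \<partial>(T \<Otimes>\<^sub>M M))"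
    by (intro nn_integral_mono) (auto simp flip: ennreal_plus split: prod.splits)
  also have "\<dots> = (\<integral>\<^sup>+x. ennreal \<bar>f x - s n x\<bar> \<partial>(T \<Otimes>\<^sub>M M)) +
      (\<integral>\<^sup>+x. ennreal \<bar>s n x - case_prod g x\<bar> \<partial>(T \<Otimes>\<^sub>M M))"
    by (rule nn_integral_add) measurable
  also have "\<dots> < ennreal (e / 2) + ennreal (e / 2)" by (rule add_strict_mono[OF n g(2)])
  also have "\<dots> = ennreal e" using \<open>0 < e\<close> by (simp flip: ennreal_plus)
  finally show "\<exists>g. L1_simple T M g \<and>
      (\<integral>\<^sup>+x. ennreal \<bar>f x - case_prod g x\<bar> \<partial>(T \<Otimes>\<^sub>M M)) < ennreal e" using g(1) by auto
qed

context pair_sigma_finite begin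

text \<open>
  The sets \<open>X\<close> with this property form a Dynkin system containing the measurable rectangles.
  Intersecting with a rectangle of finite measure gives complements as differences of two
  approximable functions, and provides the integrable majorant that countable unions need.
\<close>
lemma L1_simple_limit_indicator_Int_rectangle:
  assumes A: "A \<in> sets M1" "emeasure M1 A < \<infinity>" and B: "B \<in> sets M2" "emeasure M2 B < \<infinity>"
    and X: "X \<in> sets (M1 \<Otimes>\<^sub>M M2)"
  shows "L1_simple_limit M1 M2 (indicator (X \<inter> A \<times> B))"
proof -
  let ?R = "A \<times> B" and ?E = "{a \<times> b | a b. a \<in> sets M1 \<and> b \<in> sets M2}"
  have rect: "L1_simple_limit M1 M2 (indicator (C \<times> D))"
    if C: "C \<in> sets M1" and D: "D \<in> sets M2" "emeasure M2 D < \<infinity>" for C D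
  proof -
    have eq: "indicator (C \<times> D) = (\<lambda>(t, v). indicator C t * (indicator D v :: real))"
      by (auto simp: fun_eq_iff indicator_times)
    show ?thesis unfolding eq
      by (intro L1_simple_limit_simple L1_simple_rectangle C integrable_real_indicator D)
  qed
  have R: "integrable (M1 \<Otimes>\<^sub>M M2) (indicator ?R :: _ \<Rightarrow> real)"
    using A B by (intro integrable_real_indicator)
      (auto simp: M2.emeasure_pair_measure_Times ennreal_mult_less_top)
  have "X \<in> sigma_sets (space M1 \<times> space M2) ?E"
    using X by (simp add: sets_pair_measure)
  with Int_stable_pair_measure_generator pair_measure_closed show ?thesis
  proof (induction X rule: sigma_sets_induct_disjoint)
    case (basic X)
    then obtain C D where "X = C \<times> D" "C \<in> sets M1" "D \<in> sets M2" by auto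
    moreover have "emeasure M2 (D \<inter> B) \<le> emeasure M2 B" using B by (intro emeasure_mono) auto
    ultimately show ?case
      using rect[of "C \<inter> A" "D \<inter> B"] A B by (auto simp: Times_Int_Times less_top top_unique)
  next
    case empty
    have "L1_simple M1 M2 (\<lambda>_ _. 0)" by (rule L1_simpleI[of "{}"]) auto
    from L1_simple_limit_simple[OF this] show ?case by (simp add: split_def)
  next
    case (compl X)
    have "L1_simple_limit M1 M2 (\<lambda>x. indicator ?R x + (- 1) * indicator (X \<inter> ?R) x)"
      using A B compl by (intro L1_simple_limit_add L1_simple_limit_scale rect)
    also have "(\<lambda>x. indicator ?R x + (- 1) * indicator (X \<inter> ?R) x) =
        (indicator ((space M1 \<times> space M2 - X) \<inter> ?R) :: _ \<Rightarrow> real)"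
      using sets.sets_into_space[OF A(1)] sets.sets_into_space[OF B(1)]
      by (auto simp: fun_eq_iff split: split_indicator)
    finally show ?case .
  next
    case (union X)
    have part: "L1_simple_limit M1 M2 (\<lambda>x. \<Sum>i<n. indicator (X i \<inter> ?R) x)" for n
    proof (induction n)
      case 0
      have "L1_simple M1 M2 (\<lambda>_ _. 0)" by (rule L1_simpleI[of "{}"]) auto
      from L1_simple_limit_simple[OF this] show ?case by (simp add: split_def)
    next
      case (Suc n)
      then show ?case using L1_simple_limit_add[OF Suc union(3)[of n]] by simp
    qed
    have disj: "disjoint_family (\<lambda>i. X i \<inter> ?R)"
      using union(1) by (auto simp: disjoint_family_on_def)
    show ?case
    proof (rule L1_simple_limit_dominated[OF part _ R])
      fix x
      have "(\<lambda>i. indicator (X i \<inter> ?R) x :: real) sums indicator (\<Union>i. X i \<inter> ?R) x"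
        using disj by (intro indicator_sums) (auto simp: disjoint_family_on_def)
      then show "(\<lambda>n. \<Sum>i<n. indicator (X i \<inter> ?R) x) \<longlonglongrightarrow> (indicator ((\<Union>i. X i) \<inter> ?R) x :: real)"
        by (simp add: sums_def)
      fix n
      have "(\<Sum>i<n. indicator (X i \<inter> ?R) x :: real) = indicator (\<Union>i<n. X i \<inter> ?R) x"
        using disj by (intro indicator_UN_disjoint[symmetric]) (auto simp: disjoint_family_on_def)
      then show "\<bar>\<Sum>i<n. indicator (X i \<inter> ?R) x :: real\<bar> \<le> indicator ?R x"
        by (auto split: split_indicator)
    qed
  qed
qed

text \<open>
  Linearity and dominated convergence reduce to indicators of sets of finite measure. Such a set is
  exhausted by its intersections with an increasing sequence of rectangles of finite measure that
  covers the product.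
\<close>
lemma L1_simple_limit_integrable:
  assumes "integrable (M1 \<Otimes>\<^sub>M M2) f"
  shows "L1_simple_limit M1 M2 f"
  using assms
proof (induction rule: integrable_induct)
  case (base X c)
  obtain A where A: "range A \<subseteq> sets M1" "(\<Union>i. A i) = space M1" "\<And>i. emeasure M1 (A i) \<noteq> \<infinity>" "incseq A"
    by (rule M1.sigma_finite_incseq) blast
  obtain B where B: "range B \<subseteq> sets M2" "(\<Union>i. B i) = space M2" "\<And>i. emeasure M2 (B i) \<noteq> \<infinity>" "incseq B"
    by (rule M2.sigma_finite_incseq) blast
  have "L1_simple_limit M1 M2 (indicator X)"
  proof (rule L1_simple_limit_dominated)
    show "L1_simple_limit M1 M2 (indicator (X \<inter> A n \<times> B n))" for n
      using A B base by (intro L1_simple_limit_indicator_Int_rectangle) (auto simp: less_top)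
    show "integrable (M1 \<Otimes>\<^sub>M M2) (indicator X :: _ \<Rightarrow> real)"
      using base by (intro integrable_real_indicator) (auto simp: less_top)
    show "\<bar>indicator (X \<inter> A n \<times> B n) x :: real\<bar> \<le> indicator X x" for n x
      by (auto split: split_indicator)
    fix x assume x: "x \<in> space (M1 \<Otimes>\<^sub>M M2)"
    have "incseq (\<lambda>n. X \<inter> A n \<times> B n)"
      using A(4) B(4) by (fastforce simp: incseq_def)
    then have "(\<lambda>n. indicator (X \<inter> A n \<times> B n) x :: real) \<longlonglongrightarrow> indicator (\<Union>n. X \<inter> A n \<times> B n) x"
      by (rule LIMSEQ_indicator_incseq)
    moreover have "x \<in> (\<Union>n. A n \<times> B n)"
    proof -
      have "fst x \<in> (\<Union>i. A i)" "snd x \<in> (\<Union>j. B j)"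
        using x by (auto simp: A(2) B(2) space_pair_measure)
      then obtain i j where "fst x \<in> A i" "snd x \<in> B j" by blast
      then have "fst x \<in> A (max i j)" "snd x \<in> B (max i j)"
        using incseqD[OF A(4), of i "max i j"] incseqD[OF B(4), of j "max i j"] by auto
      then show ?thesis by (auto simp: mem_Times_iff)
    qed
    ultimately show "(\<lambda>n. indicator (X \<inter> A n \<times> B n) x :: real) \<longlonglongrightarrow> indicator X x"
      by (auto simp: indicator_def)
  qed
  from L1_simple_limit_scale[OF this, of c] show ?case by (simp add: mult.commute)
next
  case (add f g)
  then show ?case by (intro L1_simple_limit_add)
next
  case (lim f s)
  show ?case
    by (rule L1_simple_limit_dominated[of M1 M2 s f "\<lambda>x. 2 * \<bar>f x\<bar>"]) (use lim in auto)
qed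

text \<open>
  By Fubini, convergence in \<open>L\<^sup>1\<close> of the product is convergence in \<open>L\<^sup>1(M1)\<close> of the norms of the sections;
  along a subsequence these norms tend to zero almost everywhere.
\<close>
lemma L1_measurable_integrable:
  assumes f: "integrable (M1 \<Otimes>\<^sub>M M2) (\<lambda>(t, v). f t v)"
  shows "L1_measurable M1 M2 f"
proof -
  have "\<forall>n. \<exists>g. L1_simple M1 M2 g \<and>
      (\<integral>\<^sup>+x. ennreal \<bar>case_prod f x - case_prod g x\<bar> \<partial>(M1 \<Otimes>\<^sub>M M2)) < ennreal (1 / real (Suc n))"
    using L1_simple_limit_integrable[OF f] unfolding L1_simple_limit_def by auto
  then obtain g where g: "\<And>n. L1_simple M1 M2 (g n)"
      "\<And>n. (\<integral>\<^sup>+x. ennreal \<bar>case_prod f x - case_prod (g n) x\<bar> \<partial>(M1 \<Otimes>\<^sub>M M2)) < ennreal (1 / real (Suc n))"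
    by metis
  define u where "u n t = L1_norm M2 (\<lambda>v. g n t v - f t v)" for n t
  have meas: "(\<lambda>(t, v). g n t v) \<in> borel_measurable (M1 \<Otimes>\<^sub>M M2)" for n
    by (rule borel_measurable_L1_simple[OF g(1)])
  have diff: "integrable (M1 \<Otimes>\<^sub>M M2) (\<lambda>(t, v). \<bar>g n t v - f t v\<bar>)" for n
    unfolding integrable_iff_bounded
  proof
    show "(\<lambda>(t, v). \<bar>g n t v - f t v\<bar>) \<in> borel_measurable (M1 \<Otimes>\<^sub>M M2)"
      using meas[of n] borel_measurable_integrable[OF f] by (simp add: split_beta)
    show "(\<integral>\<^sup>+x. ennreal (norm (case x of (t, v) \<Rightarrow> \<bar>g n t v - f t v\<bar>)) \<partial>(M1 \<Otimes>\<^sub>M M2)) < \<infinity>"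
      using g(2)[of n] by (auto simp: split_beta abs_minus_commute less_top[symmetric])
  qed
  have u: "integrable M1 (u n)" for n
    using integrable_fst'[OF diff[of n]] by (simp add: u_def[abs_def] L1_norm_def)
  have u_bound: "(\<integral>t. norm (u n t) \<partial>M1) \<le> 1 / real (Suc n)" for n
  proof -
    have "(\<integral>t. norm (u n t) \<partial>M1) = (\<integral>t. (\<integral>v. \<bar>g n t v - f t v\<bar> \<partial>M2) \<partial>M1)"
      by (simp add: u_def L1_norm_def)
    also have "\<dots> = (\<integral>x. (case x of (t, v) \<Rightarrow> \<bar>g n t v - f t v\<bar>) \<partial>(M1 \<Otimes>\<^sub>M M2))"
      using integral_fst'[OF diff[of n]] by simp
    also have "ennreal \<dots> = (\<integral>\<^sup>+x. ennreal \<bar>case_prod f x - case_prod (g n) x\<bar> \<partial>(M1 \<Otimes>\<^sub>M M2))"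
      by (subst nn_integral_eq_integral[OF diff, symmetric]) (auto simp: split_beta abs_minus_commute)
    finally have "ennreal (\<integral>t. norm (u n t) \<partial>M1) \<le> ennreal (1 / real (Suc n))" using g(2)[of n] by simp
    then show ?thesis by (subst (asm) ennreal_le_iff) auto
  qed
  have "(\<lambda>n. \<integral>t. norm (u n t) \<partial>M1) \<longlonglongrightarrow> 0"
    by (rule tendsto_sandwich[OF _ _ tendsto_const LIMSEQ_inverse_real_of_nat])
      (use u_bound in \<open>auto simp: inverse_eq_divide\<close>)
  from tendsto_L1_AE_subseq[OF u this] obtain r where
    r: "AE t in M1. (\<lambda>n. u (r n) t) \<longlonglongrightarrow> 0" by auto
  have "AE t in M1. integrable M2 (f t) \<and> (\<lambda>n. L1_norm M2 (\<lambda>v. g (r n) t v - f t v)) \<longlonglongrightarrow> 0"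
    using r AE_integrable_fst'[OF f] by eventually_elim (simp add: u_def)
  then show ?thesis
    unfolding L1_measurable_def by (intro exI[of _ "\<lambda>n. g (r n)"]) (auto intro: g)
qed

end

section \<open>Integration over a half line\<close>

lemma space_half_line [simp]: "space (half_line s) = {s..}"
  by (simp add: half_line_def space_restrict_space)

lemma sigma_finite_half_line: "sigma_finite_measure (half_line s)"
  unfolding half_line_def by (rule sigma_finite_measure_restrict_space) (auto intro: sigma_finite_lborel)

lemma measurable_half_line_borel: "(\<lambda>t. t) \<in> borel_measurable (half_line s)"
  unfolding half_line_def by (rule measurable_restrict_space1) simp

lemma half_line_inclusion:
  assumes "r \<le> s"
  shows "(\<lambda>t. t) \<in> half_line s \<rightarrow>\<^sub>M half_line r"
  unfolding half_line_def
  by (intro measurable_restrict_space2 measurable_restrict_space1)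
    (use assms in \<open>auto simp: space_restrict_space\<close>)

lemma AE_half_line_mono:
  assumes "r \<le> s" and "AE t in half_line r. P t"
  shows "AE t in half_line s. P t"
  using assms unfolding half_line_def by (auto simp: AE_restrict_space_iff elim!: eventually_mono)

lemma set_lebesgue_integral_Icc_half_line:
  fixes f :: "real \<Rightarrow> real"
  shows "(LBINT \<tau>:{s..t}. f \<tau>) = (\<integral>\<tau>. indicator {..t} \<tau> * f \<tau> \<partial>half_line s)"
  unfolding half_line_def set_lebesgue_integral_def
  by (subst integral_restrict_space) (auto intro!: Bochner_Integration.integral_cong split: split_indicator)

text \<open>
  Where \<open>f\<close> is not integrable the left side is zero by convention. The gain can therefore be bounded at
  every time, also on the null set of times at which the emission integral diverges.
\<close>
lemma ennreal_abs_integral_le: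
  fixes f :: "'a \<Rightarrow> real"
  shows "ennreal \<bar>\<integral>x. f x \<partial>M\<bar> \<le> (\<integral>\<^sup>+x. ennreal \<bar>f x\<bar> \<partial>M)"
proof (cases "integrable M f")
  case True
  then show ?thesis using integral_norm_bound_ennreal[OF True] by simp
qed (simp add: not_integrable_integral_eq)

section \<open>Balance of emission and absorption\<close>

text \<open>
  Particles \<open>\<phi>\<close> start at time \<open>s\<close> and are removed at rate \<open>S\<close>; a particle removed from \<open>v'\<close> is
  re-emitted to \<open>v\<close> at rate \<open>b t v v'\<close>. The total emission rate \<open>sigma_h\<close> does not exceed the removal
  rate. Taking \<open>s\<close> as the origin of time makes the half line starting at \<open>s\<close> the only time domain.
\<close>
locale absorption_kernel = M: sigma_finite_measure M for M :: "'a measure" +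
  fixes S :: "real \<Rightarrow> 'a \<Rightarrow> real" and b :: "real \<Rightarrow> 'a \<Rightarrow> 'a \<Rightarrow> real"
    and s :: real and \<phi> :: "'a \<Rightarrow> real"
  assumes S_measurable: "(\<lambda>(t, v). S t v) \<in> borel_measurable (half_line s \<Otimes>\<^sub>M M)"
    and S_nonneg: "\<And>t v. s \<le> t \<Longrightarrow> v \<in> space M \<Longrightarrow> 0 \<le> S t v"
    and S_integrable: "AE v in M. \<forall>t\<ge>s. set_integrable lborel {s..t} (\<lambda>\<tau>. S \<tau> v)"
    and b_measurable: "(\<lambda>(t, v, v'). b t v v') \<in> borel_measurable (half_line s \<Otimes>\<^sub>M M \<Otimes>\<^sub>M M)"
    and b_nonneg: "\<And>t v v'. s \<le> t \<Longrightarrow> v \<in> space M \<Longrightarrow> v' \<in> space M \<Longrightarrow> 0 \<le> b t v v'"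
    and sigma_le: "AE t in half_line s. AE v in M. sigma_h M b t v \<le> ennreal (S t v)"
    and integrable_\<phi>: "integrable M \<phi>"
begin

abbreviation T :: "real measure" where "T \<equiv> half_line s"

text \<open>
  The survivors at time \<open>t\<close>: the part of \<open>\<phi>\<close> that has not yet been removed.
\<close>
abbreviation surv :: "real \<Rightarrow> 'a \<Rightarrow> real" where "surv t \<equiv> U_h S t s \<phi>"

text \<open>
  The density of newly emitted particles. For signed \<open>\<phi>\<close> it may cancel.
\<close>
abbreviation gain :: "real \<Rightarrow> 'a \<Rightarrow> real" where "gain t \<equiv> B_h M b t (surv t)"

text \<open>
  The total emission rate without cancellation, an extended number so that it is meaningful before it
  is known to be finite; finiteness is exactly membership of \<open>surv t\<close> in the domain of \<open>B_h\<close>.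
\<close>
definition production :: "real \<Rightarrow> ennreal" where
  "production t = (\<integral>\<^sup>+v. (\<integral>\<^sup>+v'. ennreal (b t v v' * \<bar>surv t v'\<bar>) \<partial>M) \<partial>M)"

definition absorption :: "real \<Rightarrow> ennreal" where
  "absorption t = (\<integral>\<^sup>+v. ennreal (S t v * \<bar>surv t v\<bar>) \<partial>M)"

sublocale T: sigma_finite_measure T by (rule sigma_finite_half_line)
sublocale TM: pair_sigma_finite T M ..
sublocale MM: pair_sigma_finite M M ..

lemma measurable_\<phi>: "\<phi> \<in> borel_measurable M"
  using integrable_\<phi> by simp

text \<open>
  Integrating over the whole half line with the integrand cut off at \<open>t\<close> turns the variable limit of
  integration into a parameter, to which measurability of parametrised integrals applies.
\<close>
lemma optical_depth_measurable:
  "(\<lambda>(t, v). LBINT \<tau>:{s..t}. S \<tau> v) \<in> borel_measurable (T \<Otimes>\<^sub>M M)"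
proof -
  have [measurable]: "(\<lambda>x. S (snd x) (snd (fst x))) \<in> borel_measurable ((T \<Otimes>\<^sub>M M) \<Otimes>\<^sub>M T)"
    using measurable_compose[OF _ S_measurable, of "\<lambda>x. (snd x, snd (fst x))" "(T \<Otimes>\<^sub>M M) \<Otimes>\<^sub>M T"] by simp
  have [measurable]: "(\<lambda>x. snd x) \<in> borel_measurable ((T \<Otimes>\<^sub>M M) \<Otimes>\<^sub>M T)"
    "(\<lambda>x. fst (fst x)) \<in> borel_measurable ((T \<Otimes>\<^sub>M M) \<Otimes>\<^sub>M T)"
    by (auto intro!: measurable_compose[OF _ measurable_half_line_borel[of s]])
  have "(\<lambda>x. \<integral>\<tau>. (if \<tau> \<le> fst x then S \<tau> (snd x) else 0) \<partial>T) \<in> borel_measurable (T \<Otimes>\<^sub>M M)"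
    by (rule T.borel_measurable_lebesgue_integral) (simp add: split_beta)
  also have "(\<lambda>x. \<integral>\<tau>. (if \<tau> \<le> fst x then S \<tau> (snd x) else 0) \<partial>T) = (\<lambda>(t, v). LBINT \<tau>:{s..t}. S \<tau> v)"
    unfolding set_lebesgue_integral_Icc_half_line
    by (auto simp: fun_eq_iff intro!: Bochner_Integration.integral_cong split: split_indicator)
  finally show ?thesis .
qed

lemma surv_measurable: "(\<lambda>(t, v). surv t v) \<in> borel_measurable (T \<Otimes>\<^sub>M M)"
proof -
  note [measurable] = optical_depth_measurable measurable_\<phi>
  show ?thesis unfolding U_h_def by measurable
qed

lemma absorption_rate_measurable: "(\<lambda>(t, v). ennreal (S t v * \<bar>surv t v\<bar>)) \<in> borel_measurable (T \<Otimes>\<^sub>M M)"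
proof -
  note [measurable] = surv_measurable S_measurable
  show ?thesis by measurable
qed

lemma kernel_section_measurable:
  assumes "s \<le> t"
  shows "(\<lambda>(v, v'). b t v v') \<in> borel_measurable (M \<Otimes>\<^sub>M M)"
proof -
  have "(\<lambda>x. (t, x)) \<in> M \<Otimes>\<^sub>M M \<rightarrow>\<^sub>M T \<Otimes>\<^sub>M M \<Otimes>\<^sub>M M"
    using assms by (intro measurable_Pair1') simp
  from measurable_compose[OF this b_measurable] show ?thesis by (simp add: split_beta)
qed

lemma surv_section_measurable:
  assumes "s \<le> t"
  shows "surv t \<in> borel_measurable M"
proof -
  have "(\<lambda>v. (t, v)) \<in> M \<rightarrow>\<^sub>M T \<Otimes>\<^sub>M M"
    using assms by (intro measurable_Pair1') simp
  from measurable_compose[OF this surv_measurable] show ?thesis by simp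
qed

lemma kernel_times_surv_measurable:
  "(\<lambda>x. b (fst (fst x)) (snd (fst x)) (snd x) * surv (fst (fst x)) (snd x)) \<in> borel_measurable ((T \<Otimes>\<^sub>M M) \<Otimes>\<^sub>M M)"
proof -
  have [measurable]: "(\<lambda>x. b (fst (fst x)) (snd (fst x)) (snd x)) \<in> borel_measurable ((T \<Otimes>\<^sub>M M) \<Otimes>\<^sub>M M)"
    using measurable_compose[OF _ b_measurable, of "\<lambda>x. (fst (fst x), snd (fst x), snd x)" "(T \<Otimes>\<^sub>M M) \<Otimes>\<^sub>M M"] by simp
  have [measurable]: "(\<lambda>x. surv (fst (fst x)) (snd x)) \<in> borel_measurable ((T \<Otimes>\<^sub>M M) \<Otimes>\<^sub>M M)"
    using measurable_compose[OF _ surv_measurable, of "\<lambda>x. (fst (fst x), snd x)" "(T \<Otimes>\<^sub>M M) \<Otimes>\<^sub>M M"] by simp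
  show ?thesis by measurable
qed

lemma gain_measurable: "(\<lambda>(t, v). gain t v) \<in> borel_measurable (T \<Otimes>\<^sub>M M)"
proof -
  have "(\<lambda>x. \<integral>v'. b (fst x) (snd x) v' * surv (fst x) v' \<partial>M) \<in> borel_measurable (T \<Otimes>\<^sub>M M)"
    using kernel_times_surv_measurable
    by (intro M.borel_measurable_lebesgue_integral) (simp add: split_beta)
  then show ?thesis by (simp add: B_h_def split_beta)
qed

lemma production_measurable: "production \<in> borel_measurable T"
proof -
  have "(\<lambda>x. ennreal \<bar>b (fst (fst x)) (snd (fst x)) (snd x) * surv (fst (fst x)) (snd x)\<bar>) \<in> borel_measurable ((T \<Otimes>\<^sub>M M) \<Otimes>\<^sub>M M)"
    by (intro measurable_compose[OF _ measurable_ennreal] borel_measurable_abs kernel_times_surv_measurable)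
  also have "?this \<longleftrightarrow> (\<lambda>x. ennreal (b (fst (fst x)) (snd (fst x)) (snd x) * \<bar>surv (fst (fst x)) (snd x)\<bar>)) \<in> borel_measurable ((T \<Otimes>\<^sub>M M) \<Otimes>\<^sub>M M)"
    by (rule measurable_cong) (auto simp: space_pair_measure abs_mult b_nonneg)
  finally have "(\<lambda>x. \<integral>\<^sup>+v'. ennreal (b (fst x) (snd x) v' * \<bar>surv (fst x) v'\<bar>) \<partial>M) \<in> borel_measurable (T \<Otimes>\<^sub>M M)"
    by (intro M.borel_measurable_nn_integral) (simp add: split_beta)
  then show ?thesis unfolding production_def[abs_def]
    by (intro M.borel_measurable_nn_integral) (simp add: split_beta)
qed

lemma optical_depth_nonneg:
  assumes "v \<in> space M"
  shows "0 \<le> (LBINT \<tau>:{s..t}. S \<tau> v)"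
  unfolding set_lebesgue_integral_def
  by (rule Bochner_Integration.integral_nonneg) (use S_nonneg assms in \<open>auto split: split_indicator\<close>)

lemma abs_surv_le: "v \<in> space M \<Longrightarrow> \<bar>surv t v\<bar> \<le> \<bar>\<phi> v\<bar>"
  using optical_depth_nonneg[of v t] by (auto simp: U_h_def abs_mult intro!: mult_left_le_one_le)

lemma integrable_surv:
  assumes "s \<le> t"
  shows "integrable M (surv t)"
  by (rule Bochner_Integration.integrable_bound[OF integrable_\<phi> surv_section_measurable[OF assms]])
    (auto simp: abs_surv_le)

lemma survival_balance:
  assumes S: "\<And>t. s \<le> t \<Longrightarrow> set_integrable lborel {s..t} (\<lambda>\<tau>. S \<tau> v)" and v: "v \<in> space M" and "s \<le> t"
  shows "(\<integral>\<^sup>+\<tau>. indicator {..t} \<tau> * ennreal (S \<tau> v * \<bar>surv \<tau> v\<bar>) \<partial>T) = ennreal (\<bar>\<phi> v\<bar> - \<bar>surv t v\<bar>)"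
proof -
  let ?E = "\<lambda>\<tau>. S \<tau> v * exp (- (LBINT r:{s..\<tau>}. S r v))"
  have "0 \<le> S \<tau> v" if "\<tau> \<in> {s..t}" for \<tau> using S_nonneg[OF _ v] that by simp
  note E = attenuated_rate_integral[OF \<open>s \<le> t\<close> S[OF \<open>s \<le> t\<close>] this]
  have "(\<integral>\<^sup>+\<tau>. indicator {..t} \<tau> * ennreal (S \<tau> v * \<bar>surv \<tau> v\<bar>) \<partial>T)
      = (\<integral>\<^sup>+\<tau>. ennreal (indicator {s..t} \<tau> *\<^sub>R ?E \<tau> * \<bar>\<phi> v\<bar>) \<partial>lborel)"
    unfolding half_line_def
    by (subst nn_integral_restrict_space)
      (auto intro!: nn_integral_cong split: split_indicator simp: U_h_def abs_mult mult.assoc)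
  also have "\<dots> = ennreal (\<integral>\<tau>. indicator {s..t} \<tau> *\<^sub>R ?E \<tau> * \<bar>\<phi> v\<bar> \<partial>lborel)"
    using E(1) S_nonneg[OF _ v] unfolding set_integrable_def
    by (intro nn_integral_eq_integral integrable_mult_left) (auto split: split_indicator)
  also have "(\<integral>\<tau>. indicator {s..t} \<tau> *\<^sub>R ?E \<tau> * \<bar>\<phi> v\<bar> \<partial>lborel) = (LBINT \<tau>:{s..t}. ?E \<tau>) * \<bar>\<phi> v\<bar>"
    by (simp add: set_lebesgue_integral_def)
  also have "(LBINT \<tau>:{s..t}. ?E \<tau>) = 1 - exp (- (LBINT \<tau>:{s..t}. S \<tau> v))"
    by (rule E(2))
  also have "\<dots> * \<bar>\<phi> v\<bar> = \<bar>\<phi> v\<bar> - \<bar>surv t v\<bar>"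
    by (simp add: U_h_def abs_mult algebra_simps)
  finally show ?thesis .
qed

text \<open>
  Tonelli's theorem reduces the total number of removed particles to the balance at each single \<open>v\<close>.
\<close>
lemma absorption_balance:
  assumes "s \<le> t"
  shows "(\<integral>\<^sup>+\<tau>. indicator {..t} \<tau> * absorption \<tau> \<partial>T) = ennreal (L1_norm M \<phi> - L1_norm M (surv t))"
proof -
  note [measurable] = absorption_rate_measurable measurable_half_line_borel
  have sec: "(\<lambda>v. ennreal (S \<tau> v * \<bar>surv \<tau> v\<bar>)) \<in> borel_measurable M" if "\<tau> \<in> space T" for \<tau>
    using measurable_compose[OF measurable_Pair1'[OF that] absorption_rate_measurable] by simp
  have "(\<integral>\<^sup>+\<tau>. indicator {..t} \<tau> * absorption \<tau> \<partial>T)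
      = (\<integral>\<^sup>+\<tau>. (\<integral>\<^sup>+v. indicator {..t} \<tau> * ennreal (S \<tau> v * \<bar>surv \<tau> v\<bar>) \<partial>M) \<partial>T)"
    unfolding absorption_def by (intro nn_integral_cong nn_integral_cmult[symmetric] sec)
  also have "\<dots> = (\<integral>\<^sup>+v. (\<integral>\<^sup>+\<tau>. indicator {..t} \<tau> * ennreal (S \<tau> v * \<bar>surv \<tau> v\<bar>) \<partial>T) \<partial>M)"
  proof (rule TM.Fubini'[symmetric])
    have "(\<lambda>x. indicator {..t} (fst x) :: ennreal) \<in> borel_measurable (T \<Otimes>\<^sub>M M)"
      by measurable
    then show "(\<lambda>(\<tau>, v). indicator {..t} \<tau> * ennreal (S \<tau> v * \<bar>surv \<tau> v\<bar>)) \<in> borel_measurable (T \<Otimes>\<^sub>M M)"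
      using absorption_rate_measurable by (simp add: split_beta)
  qed
  also have "\<dots> = (\<integral>\<^sup>+v. ennreal (\<bar>\<phi> v\<bar> - \<bar>surv t v\<bar>) \<partial>M)"
  proof (rule nn_integral_cong_AE)
    show "AE v in M. (\<integral>\<^sup>+\<tau>. indicator {..t} \<tau> * ennreal (S \<tau> v * \<bar>surv \<tau> v\<bar>) \<partial>T) = ennreal (\<bar>\<phi> v\<bar> - \<bar>surv t v\<bar>)"
      using S_integrable AE_space by eventually_elim (intro survival_balance assms; blast)
  qed
  also have "\<dots> = ennreal (\<integral>v. \<bar>\<phi> v\<bar> - \<bar>surv t v\<bar> \<partial>M)"
    using integrable_\<phi> integrable_surv[OF assms] abs_surv_le
    by (intro nn_integral_eq_integral Bochner_Integration.integrable_diff integrable_abs) auto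
  also have "(\<integral>v. \<bar>\<phi> v\<bar> - \<bar>surv t v\<bar> \<partial>M) = L1_norm M \<phi> - L1_norm M (surv t)"
    unfolding L1_norm_def using integrable_\<phi> integrable_surv[OF assms]
    by (intro Bochner_Integration.integral_diff integrable_abs)
  finally show ?thesis .
qed

lemma L1_norm_surv_le:
  assumes "s \<le> t"
  shows "L1_norm M (surv t) \<le> L1_norm M \<phi>"
  unfolding L1_norm_def using integrable_\<phi> integrable_surv[OF assms] abs_surv_le
  by (intro integral_mono) auto

lemma production_eq_sigma:
  assumes "s \<le> t"
  shows "production t = (\<integral>\<^sup>+v. sigma_h M b t v * ennreal \<bar>surv t v\<bar> \<partial>M)"
proof -
  note [measurable] = kernel_section_measurable[OF assms] surv_section_measurable[OF assms]
  have "production t = (\<integral>\<^sup>+v'. (\<integral>\<^sup>+v. ennreal (b t v v' * \<bar>surv t v'\<bar>) \<partial>M) \<partial>M)"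
    unfolding production_def by (rule MM.Fubini'[symmetric]) measurable
  also have "\<dots> = (\<integral>\<^sup>+v'. sigma_h M b t v' * ennreal \<bar>surv t v'\<bar> \<partial>M)"
  proof (rule nn_integral_cong)
    fix v' assume v': "v' \<in> space M"
    have "(\<integral>\<^sup>+v. ennreal (b t v v' * \<bar>surv t v'\<bar>) \<partial>M) = (\<integral>\<^sup>+v. ennreal (b t v v') * ennreal \<bar>surv t v'\<bar> \<partial>M)"
      by (rule nn_integral_cong) (simp add: ennreal_mult b_nonneg assms v')
    also have "\<dots> = sigma_h M b t v' * ennreal \<bar>surv t v'\<bar>"
      unfolding sigma_h_def using v' by (intro nn_integral_multc) measurable
    finally show "(\<integral>\<^sup>+v. ennreal (b t v v' * \<bar>surv t v'\<bar>) \<partial>M) = sigma_h M b t v' * ennreal \<bar>surv t v'\<bar>" .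
  qed
  finally show ?thesis .
qed

lemma absorption_eq_rate:
  assumes "s \<le> t"
  shows "absorption t = (\<integral>\<^sup>+v. ennreal (S t v) * ennreal \<bar>surv t v\<bar> \<partial>M)"
  unfolding absorption_def by (rule nn_integral_cong) (simp add: ennreal_mult S_nonneg assms)

lemma production_le_absorption: "AE t in T. production t \<le> absorption t"
  using sigma_le AE_space
proof eventually_elim
  case (elim t)
  then have t: "s \<le> t" by simp
  show ?case unfolding production_eq_sigma[OF t] absorption_eq_rate[OF t]
    by (rule nn_integral_mono_AE) (use elim(1) in \<open>auto elim!: eventually_mono intro: mult_right_mono\<close>)
qed

lemma production_eq_absorption:
  assumes "AE t in T. AE v in M. sigma_h M b t v = ennreal (S t v)"
  shows "AE t in T. production t = absorption t"
  using assms AE_space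
proof eventually_elim
  case (elim t)
  then have t: "s \<le> t" by simp
  show ?case unfolding production_eq_sigma[OF t] absorption_eq_rate[OF t]
    by (rule nn_integral_cong_AE) (use elim(1) in \<open>auto elim!: eventually_mono\<close>)
qed

lemma production_le:
  assumes "s \<le> t"
  shows "(\<integral>\<^sup>+\<tau>. indicator {..t} \<tau> * production \<tau> \<partial>T) \<le> ennreal (L1_norm M \<phi> - L1_norm M (surv t))"
  unfolding absorption_balance[OF assms, symmetric]
  by (rule nn_integral_mono_AE)
    (use production_le_absorption in \<open>auto elim!: eventually_mono intro: mult_left_mono\<close>)

text \<open>
  At most the initial mass can be removed up to any time, so the bound is uniform in time; this is what
  makes the gain integrable on the unbounded half line.
\<close>
lemma production_total_finite: "(\<integral>\<^sup>+\<tau>. production \<tau> \<partial>T) < \<infinity>"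
proof -
  note [measurable] = production_measurable measurable_half_line_borel
  have lim: "(SUP n. indicator {..s + real n} \<tau> * production \<tau>) = production \<tau>" for \<tau>
  proof (rule antisym)
    show "(SUP n. indicator {..s + real n} \<tau> * production \<tau>) \<le> production \<tau>"
      by (rule SUP_least) (auto split: split_indicator)
    obtain n where "\<tau> - s \<le> real n" using real_arch_simple by blast
    then have "production \<tau> = indicator {..s + real n} \<tau> * production \<tau>" by simp
    also have "\<dots> \<le> (SUP n. indicator {..s + real n} \<tau> * production \<tau>)" by (rule SUP_upper) simp
    finally show "production \<tau> \<le> (SUP n. indicator {..s + real n} \<tau> * production \<tau>)" .
  qed
  have "(\<integral>\<^sup>+\<tau>. production \<tau> \<partial>T) = (\<integral>\<^sup>+\<tau>. (SUP n. indicator {..s + real n} \<tau> * production \<tau>) \<partial>T)"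
    by (simp add: lim)
  also have "\<dots> = (SUP n. \<integral>\<^sup>+\<tau>. indicator {..s + real n} \<tau> * production \<tau> \<partial>T)"
    by (rule nn_integral_monotone_convergence_SUP)
      (auto simp: incseq_def le_fun_def split: split_indicator)
  also have "\<dots> \<le> ennreal (L1_norm M \<phi>)"
  proof (rule SUP_least)
    fix n
    have "(\<integral>\<^sup>+\<tau>. indicator {..s + real n} \<tau> * production \<tau> \<partial>T)
        \<le> ennreal (L1_norm M \<phi> - L1_norm M (surv (s + real n)))" by (rule production_le) simp
    also have "\<dots> \<le> ennreal (L1_norm M \<phi>)" by (rule ennreal_leI) (simp add: L1_norm_def)
    finally show "(\<integral>\<^sup>+\<tau>. indicator {..s + real n} \<tau> * production \<tau> \<partial>T) \<le> ennreal (L1_norm M \<phi>)" .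
  qed
  finally show ?thesis by (rule le_less_trans) simp
qed

lemma production_finite: "AE t in T. production t < \<infinity>"
  using nn_integral_PInf_AE[OF production_measurable] production_total_finite
  by (auto simp: less_top elim!: eventually_mono)

lemma surv_in_domain: "AE t in T. surv t \<in> dom_B_h M b t"
  using production_finite AE_space
  by eventually_elim (simp add: dom_B_h_def production_def integrable_surv)

lemma gain_le_production:
  assumes "s \<le> t"
  shows "(\<integral>\<^sup>+v. ennreal \<bar>gain t v\<bar> \<partial>M) \<le> production t"
  unfolding production_def
proof (rule nn_integral_mono)
  fix v assume v: "v \<in> space M"
  have "ennreal \<bar>gain t v\<bar> \<le> (\<integral>\<^sup>+v'. ennreal \<bar>b t v v' * surv t v'\<bar> \<partial>M)"
    unfolding B_h_def by (rule ennreal_abs_integral_le)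
  also have "\<dots> = (\<integral>\<^sup>+v'. ennreal (b t v v' * \<bar>surv t v'\<bar>) \<partial>M)"
    by (rule nn_integral_cong) (simp add: abs_mult b_nonneg assms v)
  finally show "ennreal \<bar>gain t v\<bar> \<le> \<dots>" .
qed

lemma integrable_gain: "integrable (T \<Otimes>\<^sub>M M) (\<lambda>(t, v). gain t v)"
  unfolding integrable_iff_bounded
proof (intro conjI gain_measurable)
  have m: "(\<lambda>(t, v). ennreal \<bar>gain t v\<bar>) \<in> borel_measurable (T \<Otimes>\<^sub>M M)"
    using gain_measurable by (simp add: split_beta)
  have "(\<integral>\<^sup>+x. ennreal (norm (case x of (t, v) \<Rightarrow> gain t v)) \<partial>(T \<Otimes>\<^sub>M M))
      = (\<integral>\<^sup>+t. (\<integral>\<^sup>+v. ennreal \<bar>gain t v\<bar> \<partial>M) \<partial>T)"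
    using M.nn_integral_fst[OF m] by (simp add: split_beta')
  also have "\<dots> \<le> (\<integral>\<^sup>+t. production t \<partial>T)"
    by (rule nn_integral_mono) (simp add: gain_le_production)
  also have "\<dots> < \<infinity>" by (rule production_total_finite)
  finally show "(\<integral>\<^sup>+x. ennreal (norm (case x of (t, v) \<Rightarrow> gain t v)) \<partial>(T \<Otimes>\<^sub>M M)) < \<infinity>" .
qed

lemma L1_measurable_gain: "L1_measurable T M gain"
  by (rule TM.L1_measurable_integrable[OF integrable_gain])

lemma integrable_L1_norm_gain: "integrable T (\<lambda>t. L1_norm M (gain t))"
  using TM.integrable_fst'[OF integrable_abs[OF integrable_gain]] by (simp add: L1_norm_def)

lemma set_integrable_L1_norm_gain: "set_integrable lborel {s..t} (\<lambda>\<tau>. L1_norm M (gain \<tau>))"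
proof (rule set_integrable_subset)
  show "set_integrable lborel {s..} (\<lambda>\<tau>. L1_norm M (gain \<tau>))"
    using integrable_L1_norm_gain unfolding half_line_def set_integrable_def
    by (subst (asm) integrable_restrict_space) auto
qed auto

lemma gain_norm_integral:
  "ennreal (LBINT \<tau>:{s..t}. L1_norm M (gain \<tau>))
    = (\<integral>\<^sup>+\<tau>. indicator {..t} \<tau> * (\<integral>\<^sup>+v. ennreal \<bar>gain \<tau> v\<bar> \<partial>M) \<partial>T)"
proof -
  have ind: "(indicator {..t} :: real \<Rightarrow> real) \<in> borel_measurable T"
    by (rule measurable_compose[OF measurable_half_line_borel borel_measurable_indicator]) simp
  have int: "integrable T (\<lambda>\<tau>. indicator {..t} \<tau> * L1_norm M (gain \<tau>))"
    by (rule Bochner_Integration.integrable_bound[OF integrable_L1_norm_gain])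
      (use ind borel_measurable_integrable[OF integrable_L1_norm_gain] in \<open>auto split: split_indicator\<close>)
  have "ennreal (LBINT \<tau>:{s..t}. L1_norm M (gain \<tau>)) = (\<integral>\<^sup>+\<tau>. ennreal (indicator {..t} \<tau> * L1_norm M (gain \<tau>)) \<partial>T)"
    unfolding set_lebesgue_integral_Icc_half_line
    by (rule nn_integral_eq_integral[OF int, symmetric]) (auto simp: L1_norm_def)
  also have "\<dots> = (\<integral>\<^sup>+\<tau>. indicator {..t} \<tau> * (\<integral>\<^sup>+v. ennreal \<bar>gain \<tau> v\<bar> \<partial>M) \<partial>T)"
  proof (rule nn_integral_cong_AE)
    show "AE \<tau> in T. ennreal (indicator {..t} \<tau> * L1_norm M (gain \<tau>))
        = indicator {..t} \<tau> * (\<integral>\<^sup>+v. ennreal \<bar>gain \<tau> v\<bar> \<partial>M)"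
      using TM.AE_integrable_fst'[OF integrable_gain]
    proof eventually_elim
      case (elim \<tau>)
      then have "(\<integral>\<^sup>+v. ennreal \<bar>gain \<tau> v\<bar> \<partial>M) = ennreal (L1_norm M (gain \<tau>))"
        unfolding L1_norm_def by (intro nn_integral_eq_integral) auto
      then show ?case by (simp split: split_indicator)
    qed
  qed
  finally show ?thesis .
qed

lemma gain_norm_integral_nonneg: "0 \<le> (LBINT \<tau>:{s..t}. L1_norm M (gain \<tau>))"
  unfolding set_lebesgue_integral_def
  by (rule Bochner_Integration.integral_nonneg) (simp add: L1_norm_def)

lemma gain_le_loss:
  assumes "s \<le> t"
  shows "(LBINT \<tau>:{s..t}. L1_norm M (gain \<tau>)) \<le> L1_norm M \<phi> - L1_norm M (surv t)"
proof -
  have "ennreal (LBINT \<tau>:{s..t}. L1_norm M (gain \<tau>)) \<le> (\<integral>\<^sup>+\<tau>. indicator {..t} \<tau> * production \<tau> \<partial>T)"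
    unfolding gain_norm_integral by (intro nn_integral_mono mult_left_mono gain_le_production) auto
  also have "\<dots> \<le> ennreal (L1_norm M \<phi> - L1_norm M (surv t))" by (rule production_le[OF assms])
  finally show ?thesis using L1_norm_surv_le[OF assms] by (subst (asm) ennreal_le_iff) auto
qed

text \<open>
  For nonnegative \<open>\<phi>\<close> nothing cancels. Where the inner integral is finite, which is almost everywhere
  since \<open>production t\<close> is finite, it equals the Bochner integral defining the gain.
\<close>
lemma gain_eq_production:
  assumes pos: "AE v in M. 0 \<le> \<phi> v"
  shows "AE t in T. (\<integral>\<^sup>+v. ennreal \<bar>gain t v\<bar> \<partial>M) = production t"
  using production_finite AE_space
proof eventually_elim
  case (elim t)
  then have t: "s \<le> t" by simp
  note [measurable] = kernel_section_measurable[OF t] surv_section_measurable[OF t]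
  let ?k = "\<lambda>v. \<integral>\<^sup>+v'. ennreal (b t v v' * \<bar>surv t v'\<bar>) \<partial>M"
  have "?k \<in> borel_measurable M" by measurable
  then have fin: "AE v in M. ?k v \<noteq> \<infinity>"
    using elim(1) by (intro nn_integral_PInf_AE) (auto simp: production_def)
  show ?case unfolding production_def
  proof (rule nn_integral_cong_AE)
    show "AE v in M. ennreal \<bar>gain t v\<bar> = ?k v"
      using fin AE_space
    proof eventually_elim
      case (elim v)
      have abs: "AE v' in M. b t v v' * \<bar>surv t v'\<bar> = b t v v' * surv t v'"
        using pos by (auto simp: U_h_def abs_mult elim!: eventually_mono)
      have [measurable]: "(\<lambda>v'. b t v v') \<in> borel_measurable M"
        using measurable_compose[OF measurable_Pair1'[OF elim(2)] kernel_section_measurable[OF t]] by simp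
      have int: "integrable M (\<lambda>v'. b t v v' * \<bar>surv t v'\<bar>)"
        using elim by (intro integrableI_nonneg) (auto simp: b_nonneg t less_top)
      then have "?k v = ennreal (\<integral>v'. b t v v' * \<bar>surv t v'\<bar> \<partial>M)"
        using elim(2) by (intro nn_integral_eq_integral) (auto simp: b_nonneg t)
      also have "(\<integral>v'. b t v v' * \<bar>surv t v'\<bar> \<partial>M) = gain t v"
        unfolding B_h_def using abs by (intro integral_cong_AE) auto
      finally have k: "?k v = ennreal (gain t v)" .
      have "0 \<le> (\<integral>v'. b t v v' * \<bar>surv t v'\<bar> \<partial>M)"
        using elim(2) by (intro Bochner_Integration.integral_nonneg) (auto simp: b_nonneg t)
      then have "0 \<le> gain t v" using \<open>(\<integral>v'. b t v v' * \<bar>surv t v'\<bar> \<partial>M) = gain t v\<close> by simp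
      then show ?case by (simp add: k)
    qed
  qed
qed

lemma gain_eq_loss:
  assumes "s \<le> t" and sigma: "AE t in T. AE v in M. sigma_h M b t v = ennreal (S t v)"
    and pos: "AE v in M. 0 \<le> \<phi> v"
  shows "(LBINT \<tau>:{s..t}. L1_norm M (gain \<tau>)) = L1_norm M \<phi> - L1_norm M (surv t)"
proof -
  have "ennreal (LBINT \<tau>:{s..t}. L1_norm M (gain \<tau>)) = (\<integral>\<^sup>+\<tau>. indicator {..t} \<tau> * absorption \<tau> \<partial>T)"
    unfolding gain_norm_integral
  proof (rule nn_integral_cong_AE)
    show "AE \<tau> in T. indicator {..t} \<tau> * (\<integral>\<^sup>+v. ennreal \<bar>gain \<tau> v\<bar> \<partial>M) = indicator {..t} \<tau> * absorption \<tau>"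
      using gain_eq_production[OF pos] production_eq_absorption[OF sigma] by eventually_elim simp
  qed
  then show ?thesis
    using gain_norm_integral_nonneg[of t] L1_norm_surv_le[OF \<open>s \<le> t\<close>] by (simp add: absorption_balance[OF \<open>s \<le> t\<close>])
qed

end

section \<open>The transport operators on the support\<close>

lemma closed_measure_support: "closed (measure_support \<mu>)"
proof -
  have "- measure_support \<mu> = \<Union>{U. open U \<and> \<not> emeasure \<mu> U > 0}"
    by (auto simp: measure_support_def)
  then show ?thesis by (auto simp: closed_def)
qed

lemma space_on_support:
  "sets \<mu> = sets borel \<Longrightarrow> space (on_support \<mu>) = measure_support \<mu>"
  unfolding on_support_def by (simp add: space_restrict_space sets_eq_imp_space_eq)

lemma sigma_finite_on_support:
  assumes "sets \<mu> = sets borel" "sigma_finite_measure \<mu>"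
  shows "sigma_finite_measure (on_support \<mu>)"
  unfolding on_support_def using assms closed_measure_support[of \<mu>]
  by (intro sigma_finite_measure_restrict_space) auto

theorem proposition5p6:
  fixes \<mu> :: "(real ^ 'd) measure"
    and \<Sigma> :: "real \<Rightarrow> real ^ 'd \<Rightarrow> real"
    and b :: "real \<Rightarrow> real ^ 'd \<Rightarrow> real ^ 'd \<Rightarrow> real"
    and \<phi> :: "real ^ 'd \<Rightarrow> real"
    and s :: real
  assumes borel_\<mu>: "sets \<mu> = sets borel" "sigma_finite_measure \<mu>"
    and \<Sigma>_measurable:
      "(\<lambda>(t, v). \<Sigma> t v) \<in> borel_measurable (half_line 0 \<Otimes>\<^sub>M on_support \<mu>)"
    and \<Sigma>_nonneg: "\<And>t v. 0 \<le> t \<Longrightarrow> v \<in> measure_support \<mu> \<Longrightarrow> 0 \<le> \<Sigma> t v"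
    and \<Sigma>_locally_integrable:
      "AE v in on_support \<mu>. locally_integrable_on (\<lambda>t. \<Sigma> t v) {0..}"
    and b_measurable:
      "(\<lambda>(t, v, v'). b t v v') \<in> borel_measurable (half_line 0 \<Otimes>\<^sub>M on_support \<mu> \<Otimes>\<^sub>M on_support \<mu>)"
    and b_nonneg: "\<And>t v v'. 0 \<le> t \<Longrightarrow> v \<in> measure_support \<mu> \<Longrightarrow> v' \<in> measure_support \<mu> \<Longrightarrow> 0 \<le> b t v v'"
    and b_le_\<Sigma>:
      "AE (t, v') in half_line 0 \<Otimes>\<^sub>M on_support \<mu>.
         (\<integral>\<^sup>+v. ennreal (b t v v') \<partial>on_support \<mu>) \<le> ennreal (\<Sigma> t v')"
    and \<phi>_L1: "integrable (on_support \<mu>) \<phi>"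
    and s_nonneg: "0 \<le> s"
  shows "(AE t in half_line s. U_h \<Sigma> t s \<phi> \<in> dom_B_h (on_support \<mu>) b t) \<and>
    L1_measurable (half_line s) (on_support \<mu>) (\<lambda>t. B_h (on_support \<mu>) b t (U_h \<Sigma> t s \<phi>)) \<and>
    (\<forall>t\<ge>s.
      set_integrable lborel {s..t} (\<lambda>\<tau>. L1_norm (on_support \<mu>) (B_h (on_support \<mu>) b \<tau> (U_h \<Sigma> \<tau> s \<phi>))) \<and>
      (LBINT \<tau>:{s..t}. L1_norm (on_support \<mu>) (B_h (on_support \<mu>) b \<tau> (U_h \<Sigma> \<tau> s \<phi>)))
        \<le> L1_norm (on_support \<mu>) \<phi> - L1_norm (on_support \<mu>) (U_h \<Sigma> t s \<phi>)) \<and>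
    ((AE (t, v) in half_line 0 \<Otimes>\<^sub>M on_support \<mu>. sigma_h (on_support \<mu>) b t v = ennreal (\<Sigma> t v)) \<longrightarrow>
     (AE v in on_support \<mu>. 0 \<le> \<phi> v) \<longrightarrow>
     (\<forall>t\<ge>s.
      (LBINT \<tau>:{s..t}. L1_norm (on_support \<mu>) (B_h (on_support \<mu>) b \<tau> (U_h \<Sigma> \<tau> s \<phi>)))
        = L1_norm (on_support \<mu>) \<phi> - L1_norm (on_support \<mu>) (U_h \<Sigma> t s \<phi>)))"
proof -
  let ?V = "on_support \<mu>"
  interpret V: sigma_finite_measure ?V by (rule sigma_finite_on_support[OF borel_\<mu>])
  interpret H: sigma_finite_measure "half_line 0" by (rule sigma_finite_half_line)
  interpret HV: pair_sigma_finite "half_line 0" ?V ..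
  have V: "space ?V = measure_support \<mu>" by (rule space_on_support[OF borel_\<mu>(1)])
  note incl = half_line_inclusion[OF s_nonneg]
  interpret absorption_kernel ?V \<Sigma> b s \<phi>
  proof
    have "(\<lambda>x. (fst x, snd x)) \<in> half_line s \<Otimes>\<^sub>M ?V \<rightarrow>\<^sub>M half_line 0 \<Otimes>\<^sub>M ?V"
      by (intro measurable_Pair measurable_compose[OF measurable_fst incl]) simp
    from measurable_compose[OF this \<Sigma>_measurable]
    show "(\<lambda>(t, v). \<Sigma> t v) \<in> borel_measurable (half_line s \<Otimes>\<^sub>M ?V)" by (simp add: split_beta)
    have "(\<lambda>x. (fst x, snd x)) \<in> half_line s \<Otimes>\<^sub>M ?V \<Otimes>\<^sub>M ?V \<rightarrow>\<^sub>M half_line 0 \<Otimes>\<^sub>M ?V \<Otimes>\<^sub>M ?V"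
      by (intro measurable_Pair measurable_compose[OF measurable_fst incl]) simp
    from measurable_compose[OF this b_measurable]
    show "(\<lambda>(t, v, v'). b t v v') \<in> borel_measurable (half_line s \<Otimes>\<^sub>M ?V \<Otimes>\<^sub>M ?V)" by (simp add: split_beta)
    show "AE v in ?V. \<forall>t\<ge>s. set_integrable lborel {s..t} (\<lambda>\<tau>. \<Sigma> \<tau> v)"
      using \<Sigma>_locally_integrable by eventually_elim (use s_nonneg in \<open>auto simp: locally_integrable_on_def\<close>)
    show "AE t in half_line s. AE v in ?V. sigma_h ?V b t v \<le> ennreal (\<Sigma> t v)"
      using HV.AE_pair[OF b_le_\<Sigma>] unfolding sigma_h_def
      by (intro AE_half_line_mono[OF s_nonneg]) simp
  qed (use \<Sigma>_nonneg b_nonneg \<phi>_L1 s_nonneg V in auto)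
  have sigma: "AE t in half_line s. AE v in ?V. sigma_h ?V b t v = ennreal (\<Sigma> t v)"
    if "AE (t, v) in half_line 0 \<Otimes>\<^sub>M ?V. sigma_h ?V b t v = ennreal (\<Sigma> t v)"
    using HV.AE_pair[OF that] by (intro AE_half_line_mono[OF s_nonneg]) simp
  show ?thesis
    using surv_in_domain L1_measurable_gain set_integrable_L1_norm_gain gain_le_loss gain_eq_loss sigma by blast
qed

end
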